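(* Let $k\ge2$ and $n\ge0$, and let $\epsilon_i$ denote the $i$-th unit coordinate vector in $\mathbb{R}^{k-1}$. The number of set partitions $P$ of $[n]$ with $\mathrm{cr}(P)<k$ equals the number of lattice walks $v_0,v_1,\dots,v_{2n}$ in the region \[ V_k=\{(a_1,\dots,a_{k-1})\in\mathbb{Z}^{k-1}: a_1\ge a_2\ge\cdots\ge a_{k-1}\ge0\} \] with $v_0=v_{2n}=0$, such that each step $v_{m+1}-v_m$ is some $\pm\epsilon_i$ or the zero vector, and such that for $m$ even the step $v_{m+1}-v_m$ is either $-\epsilon_i$ for some $i$ or $0$, while for $m$ odd the step is either $+\epsilon_i$ for some $i$ or $0$.
   Context: For a set partition $P$ of $[n]$, its standard representation is the set of arcs $(a,b)$, $a<b$, joining consecutive elements (in numerical order) of each block. A $k$-crossing of $P$ is a set of $k$ arcs $(i_1,j_1),\dots,(i_k,j_k)$ of the standard representation with $i_1<\cdots<i_k<j_1<\cdots<j_k$, and $\mathrm{cr}(P)$ is the maximal $k$ such that $P$ has a $k$-crossing (a single arc counting as a $1$-crossing, and $\mathrm{cr}(P)=0$ if there are no arcs). *)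

theory Defs
  imports Main "HOL-Library.Disjoint_Sets" "HOL-Library.Function_Algebras"
begin

definition arcs :: "nat set set \<Rightarrow> (nat \<times> nat) set" where
  "arcs P = {(a, b). a < b \<and> (\<exists>B\<in>P. a \<in> B \<and> b \<in> B \<and> (\<forall>c\<in>B. \<not> (a < c \<and> c < b)))}"

definition is_crossing :: "nat \<Rightarrow> nat set set \<Rightarrow> (nat \<times> nat) set \<Rightarrow> bool" where
  "is_crossing k P C \<longleftrightarrow> C \<subseteq> arcs P \<and>
     (\<exists>is js. length is = k \<and> length js = k \<and> C = set (zip is js) \<and> sorted_wrt (<) (is @ js))"

text \<open>The empty set is a 0-crossing, so \<open>cr P = 0\<close> when there are no arcs.\<close>

definition cr :: "nat set set \<Rightarrow> nat" where
  "cr P = Max {k. \<exists>C. is_crossing k P C}"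

lemma is_crossing_card:
  assumes "is_crossing k P C"
  shows "card C = k"
proof -
  obtain "is" js where *: "length is = k" "length js = k" "C = set (zip is js)"
      "sorted_wrt (<) (is @ js)"
    using assms unfolding is_crossing_def by blast
  have "distinct is"
    using *(4) by (simp add: sorted_wrt_append strict_sorted_iff)
  then have "distinct (zip is js)"
    by (rule distinct_zipI1)
  from distinct_card[OF this] show ?thesis
    using *(1-3) by simp
qed

lemma arcs_finite:
  assumes "partition_on {1..n} P"
  shows "finite (arcs P)"
proof (rule finite_subset)
  show "arcs P \<subseteq> {1..n} \<times> {1..n}"
    using partition_onD1[OF assms] unfolding arcs_def by blast
qed simp

text \<open>The maximum defining \<open>cr\<close> is therefore taken over a finite nonempty set.\<close>

lemma finite_crossing_sizes:
  assumes "partition_on {1..n} P"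
  shows "finite {k. \<exists>C. is_crossing k P C}" "0 \<in> {k. \<exists>C. is_crossing k P C}"
proof -
  have "k \<le> card (arcs P)" if "is_crossing k P C" for k C
    using card_mono[OF arcs_finite[OF assms], of C] is_crossing_card[OF that] that
    by (simp add: is_crossing_def)
  then have "{k. \<exists>C. is_crossing k P C} \<subseteq> {..card (arcs P)}"
    by blast
  then show "finite {k. \<exists>C. is_crossing k P C}"
    by (rule finite_subset) simp
  show "0 \<in> {k. \<exists>C. is_crossing k P C}"
    by (simp add: is_crossing_def)
qed

text \<open>A vector with integer coordinates \<open>a\<^sub>1, \<dots>, a\<^sub>d\<close> is represented by a function on
  \<open>nat\<close> that vanishes outside \<open>{1..d}\<close>, with pointwise \<open>0\<close>, negation and subtraction.\<close>

definition unit_vec :: "nat \<Rightarrow> nat \<Rightarrow> int" where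
  "unit_vec i = (\<lambda>j. if j = i then 1 else 0)"

definition V :: "nat \<Rightarrow> (nat \<Rightarrow> int) set" where
  "V k = {a. (\<forall>i. i \<notin> {1..k-1} \<longrightarrow> a i = 0) \<and>
             (\<forall>i\<in>{1..<k-1}. a i \<ge> a (i + 1)) \<and> a (k - 1) \<ge> 0}"

text \<open>A walk \<open>v\<^sub>0, \<dots>, v\<^sub>2\<^sub>n\<close> is the list of its \<open>2n + 1\<close> points.\<close>

definition walks :: "nat \<Rightarrow> nat \<Rightarrow> (nat \<Rightarrow> int) list set" where
  "walks k n = {v. length v = 2 * n + 1 \<and> set v \<subseteq> V k \<and> v ! 0 = 0 \<and> v ! (2 * n) = 0 \<and>
     (\<forall>m<2 * n. v ! (m + 1) - v ! m \<in>
        {0} \<union> unit_vec ` {1..k-1} \<union> (\<lambda>i. - unit_vec i) ` {1..k-1}) \<and>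
     (\<forall>m<2 * n. even m \<longrightarrow> v ! (m + 1) - v ! m \<in> {0} \<union> (\<lambda>i. - unit_vec i) ` {1..k-1}) \<and>
     (\<forall>m<2 * n. odd m \<longrightarrow> v ! (m + 1) - v ! m \<in> {0} \<union> unit_vec ` {1..k-1})}"

end

theory Submission imports Defs begin

text \<open>Read a partition from right to left. At each time the open arcs, ordered by decreasing
  closer, form a word in their openers; a \<open>k\<close>-crossing is a decreasing subsequence of length \<open>k\<close>
  of such a word. Closing an arc appends its opener to the word, and passing an opener deletes the
  largest letter. Under RSK the first operation adds a corner to the shape of the word and the
  second one removes a corner, each in a reversible way, so the partition corresponds to a walk of
  shapes, and by Schensted the number of rows of the shape is the length of the longest decreasing
  subsequence.

  No tableaux are needed: an insertion tableau is stored as its lattice word, whose entry at label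
  \<open>a\<close> is the row of \<open>a\<close> (or \<open>None\<close> if \<open>a\<close> is not open). Row insertion then becomes a single pass
  of the local rule of growth diagrams, deletion of the largest label drops the last entry, and
  decreasing subsequences of the word with letters in an interval correspond to strictly increasing
  subsequences of the lattice word restricted to that interval.\<close>

section \<open>Row insertion on lattice words\<close>

text \<open>In \<open>bump b\<close>, the inserted path currently occupies the new corner in row \<open>b\<close>.\<close>

fun bump :: "nat \<Rightarrow> nat option list \<Rightarrow> nat option list" where
  "bump b [] = []"
| "bump b (x # xs) = (if x = Some b then Some (Suc b) # bump (Suc b) xs else x # bump b xs)"

fun carry :: "nat \<Rightarrow> nat option list \<Rightarrow> nat" where
  "carry b [] = b"
| "carry b (x # xs) = (if x = Some b then carry (Suc b) xs else carry b xs)"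

text \<open>Row insertion of the label \<open>a\<close>: smaller labels keep their rows,
  \<open>a\<close> enters row 1, and larger labels are displaced along the path starting there. The
  entry at \<open>a\<close> is overwritten, so later statements ask for \<open>None\<close>
  there.\<close>

definition place :: "nat \<Rightarrow> nat option list \<Rightarrow> nat option list" where
  "place a xs = take a xs @ Some 1 # bump 1 (drop (Suc a) xs)"

definition new_row :: "nat \<Rightarrow> nat option list \<Rightarrow> nat" where
  "new_row a xs = carry 1 (drop (Suc a) xs)"

text \<open>Length of a longest strictly increasing subsequence of rows, all at least
  \<open>c\<close>. The threshold makes the recursion local: choosing \<open>r\<close> raises it to
  \<open>Suc r\<close>.\<close>

fun lis :: "nat \<Rightarrow> nat option list \<Rightarrow> nat" where
  "lis c [] = 0"
| "lis c (None # xs) = lis c xs"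
| "lis c (Some r # xs) = (if c \<le> r then max (Suc (lis (Suc r) xs)) (lis c xs) else lis c xs)"

section \<open>Increasing subsequences under bumping and insertion\<close>

lemma lis_antimono: "c \<le> d \<Longrightarrow> lis d xs \<le> lis c xs"
proof (induction c xs rule: lis.induct)
  case (3 c r xs)
  then show ?case
    by (cases "c \<le> r"; cases "d \<le> r") auto
qed auto

lemma lis_le_Suc: "lis c xs \<le> Suc (lis (Suc c) xs)"
proof (induction c xs rule: lis.induct)
  case (3 c r xs)
  then show ?case
    using lis_antimono[of "Suc c" "Suc r" xs] by (auto simp: not_less_eq_eq le_Suc_eq)
qed auto

text \<open>The parts need each other: when an entry \<open>b\<close> becomes \<open>Suc b\<close>,
  its successors have to exceed a larger value, and the second part at \<open>Suc b\<close> says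
  that bumping the rest makes up for this.\<close>

lemma lis_bump_ge: "lis c xs \<le> lis c (bump b xs)" "lis b xs \<le> lis (Suc b) (bump b xs)"
proof (induction xs arbitrary: b c)
  case (Cons x xs)
  { case 1
    show ?case
    proof (cases "x = Some b")
      case True
      then show ?thesis
        using Cons.IH(1)[of c "Suc b"] Cons.IH(2)[of "Suc b"]
          lis_antimono[of c "Suc (Suc b)" "bump (Suc b) xs"] by auto
    next
      case False
      then show ?thesis
        using Cons.IH(1)[of c b] Cons.IH(1)[of "Suc (the x)" b] by (cases x) auto
    qed
  next
    case 2
    show ?case
    proof (cases "x = Some b")
      case True
      then show ?thesis
        using Cons.IH(2)[of "Suc b"] lis_le_Suc[of b xs] by auto
    next
      case False
      then show ?thesis
        using Cons.IH(2)[of b] Cons.IH(1)[of "Suc (the x)" b] by (cases x) auto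
    qed }
qed auto

text \<open>The second bound covers all \<open>c\<close> above \<open>b\<close> so that the joint
  induction closes. The difference \<open>c - Suc b\<close> counts the entries, with rows from
  \<open>b\<close> up to but not including \<open>c - 1\<close>, that are bumped before any entry
  can be bumped into row \<open>c\<close>.\<close>

lemma lis_bump_le:
  "c \<le> b \<Longrightarrow> lis c (bump b xs) \<le> lis c xs"
  "b < c \<Longrightarrow> lis c (bump b xs) \<le> max (lis c xs) (lis b xs - (c - Suc b))"
proof (induction xs arbitrary: b c)
  case (Cons x xs)
  { case 1
    show ?case
    proof (cases "x = Some b")
      case True
      then show ?thesis
        using 1 Cons.IH(1)[of c "Suc b"] Cons.IH(2)[of "Suc b" "Suc (Suc b)"]
          lis_antimono[of "Suc b" "Suc (Suc b)" xs] by auto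
    next
      case False
      show ?thesis
      proof (cases x)
        case (Some r)
        with False 1 have "r < b \<or> b < r"
          by auto
        then show ?thesis
          using Some False 1 Cons.IH(1)[of c b] Cons.IH(1)[of "Suc r" b] Cons.IH(2)[of b "Suc r"]
            lis_antimono[of c b xs] by auto
      qed (use 1 Cons.IH(1)[of c b] in auto)
    qed
  next
    case 2
    show ?case
    proof (cases "x = Some b")
      case True
      show ?thesis
      proof (cases "c = Suc b")
        case c: True
        then show ?thesis
          using True Cons.IH(2)[of "Suc b" "Suc (Suc b)"] Cons.IH(1)[of "Suc b" "Suc b"]
            lis_antimono[of "Suc b" "Suc (Suc b)" xs] by auto
      next
        case c: False
        then show ?thesis
          using 2 True Cons.IH(2)[of "Suc b" c] by auto
      qed
    next
      case False
      show ?thesis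
      proof (cases x)
        case (Some r)
        then show ?thesis
          using Some False 2 Cons.IH(2)[of b c] Cons.IH(2)[of b "Suc r"] by auto
      qed (use 2 Cons.IH(2)[of b c] in auto)
    qed }
qed auto

lemma lis_bump: "c \<le> b \<Longrightarrow> lis c (bump b xs) = lis c xs"
  using lis_bump_ge(1) lis_bump_le(1) by (simp add: eq_iff)

lemma lis_Suc_bump: "lis (Suc b) (bump b xs) = lis b xs"
  using lis_bump_le(2)[of b "Suc b" xs] lis_antimono[of b "Suc b" xs] lis_bump_ge(2)[of b xs] by auto

text \<open>Stated for every positive \<open>c\<close> because an entry \<open>Some r\<close> of the
  prefix raises the threshold to \<open>Suc r\<close>.\<close>

lemma lis_insert_le:
  "0 < c \<Longrightarrow> lis c (us @ Some 1 # bump 1 vs) \<le> max (lis c (us @ vs)) (lis 1 vs + 2 - c)"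
proof (induction us arbitrary: c)
  case Nil
  then show ?case
    using lis_bump_le(2)[of 1 c vs] lis_Suc_bump[of 1 vs] lis_bump[of 1 1 vs]
    by (cases "c = 1") auto
next
  case (Cons x us)
  show ?case
    using Cons.prems Cons.IH[of c] Cons.IH[of "Suc (the x)"] by (cases x) auto
qed

lemma lis_append_ge: "lis c vs \<le> lis c (us @ vs)"
  by (induction c us rule: lis.induct) auto

lemma lis_append_mono: "(\<And>c. lis c vs \<le> lis c ws) \<Longrightarrow> lis c (us @ vs) \<le> lis c (us @ ws)"
  by (induction c us rule: lis.induct) (auto simp: le_max_iff_disj)

text \<open>Schensted's step: a longest decreasing subsequence of the extended word either avoids
  the appended letter or ends with it, after larger letters, whose rows form \<open>vs\<close>.
  Crossings obey the same recursion in \<open>crossing_insert\<close>.\<close>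

lemma lis_insert:
  "lis 1 (us @ Some 1 # bump 1 vs) = max (lis 1 (us @ vs)) (Suc (lis 1 vs))"
proof (rule antisym)
  show "lis 1 (us @ Some 1 # bump 1 vs) \<le> max (lis 1 (us @ vs)) (Suc (lis 1 vs))"
    using lis_insert_le[of 1 us vs] by simp
  have "lis c vs \<le> lis c (Some 1 # bump 1 vs)" for c
    using lis_bump_ge(1)[of c vs 1] by auto
  moreover have "Suc (lis 1 vs) \<le> lis 1 (Some 1 # bump 1 vs)"
    using lis_bump_ge(2)[of 1 vs] by auto
  ultimately show "max (lis 1 (us @ vs)) (Suc (lis 1 vs)) \<le> lis 1 (us @ Some 1 # bump 1 vs)"
    using lis_append_mono[of vs "Some 1 # bump 1 vs" 1 us]
      lis_append_ge[of 1 "Some 1 # bump 1 vs" us] by auto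
qed

section \<open>Insertion on prefixes, suffixes and the last entry\<close>

lemma length_bump [simp]: "length (bump b xs) = length xs"
  by (induction b xs rule: bump.induct) auto

lemma take_bump: "take i (bump b xs) = bump b (take i xs)"
  by (induction b xs arbitrary: i rule: bump.induct) (auto simp: take_Cons split: nat.split)

lemma drop_bump: "drop i (bump b xs) = bump (carry b (take i xs)) (drop i xs)"
  by (induction b xs arbitrary: i rule: bump.induct) (auto simp: take_Cons drop_Cons split: nat.split)

lemma bump_snoc:
  "bump b (xs @ [x]) = bump b xs @ [if x = Some (carry b xs) then Some (Suc (carry b xs)) else x]"
  by (induction b xs rule: bump.induct) auto

lemma carry_snoc:
  "carry b (xs @ [x]) = (if x = Some (carry b xs) then Suc (carry b xs) else carry b xs)"
  by (induction b xs rule: bump.induct) auto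

lemma carry_ge: "b \<le> carry b xs"
  by (induction b xs rule: carry.induct) auto

lemma length_place [simp]: "a < length xs \<Longrightarrow> length (place a xs) = length xs"
  by (simp add: place_def)

text \<open>One cell of a growth diagram: the corner added to the prefix and the row of the last
  label determine the new row of that label and the corner added to the whole word.\<close>

lemma place_snoc:
  assumes "a < length xs"
  shows "place a (xs @ [x]) =
    place a xs @ [if x = Some (new_row a xs) then Some (Suc (new_row a xs)) else x]"
    "new_row a (xs @ [x]) = (if x = Some (new_row a xs) then Suc (new_row a xs) else new_row a xs)"
  using assms by (simp_all add: place_def new_row_def bump_snoc carry_snoc)

lemma place_last [simp]: "place (length xs) (xs @ [x]) = xs @ [Some 1]"
  "new_row (length xs) (xs @ [x]) = 1"
  by (simp_all add: place_def new_row_def)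

lemma new_row_pos: "0 < new_row a xs"
  using carry_ge[of 1] by (simp add: new_row_def Suc_le_eq)

lemma place_nth_eq_None_iff:
  assumes "a < length xs" "i < length xs"
  shows "place a xs ! i = None \<longleftrightarrow> i \<noteq> a \<and> xs ! i = None"
proof -
  have bump_nth: "bump b ys ! j = None \<longleftrightarrow> ys ! j = None" if "j < length ys" for b ys j
    using that by (induction b ys arbitrary: j rule: bump.induct) (auto simp: nth_Cons split: nat.splits)
  show ?thesis
  proof (cases "a < i")
    case True
    then obtain j where "i = Suc (a + j)"
      using less_imp_Suc_add by blast
    then show ?thesis
      using assms by (simp add: place_def nth_append bump_nth)
  qed (use assms in \<open>auto simp: place_def nth_append nth_Cons split: nat.splits\<close>)
qed

section \<open>Shapes\<close>

text \<open>Row lengths of an integer partition; rows are numbered from 1, so index 0 is forced to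
  0.\<close>

definition dominant :: "(nat \<Rightarrow> int) \<Rightarrow> bool" where
  "dominant v \<longleftrightarrow> v 0 = 0 \<and> (\<forall>i. 0 \<le> v i) \<and> (\<forall>i\<ge>1. v (Suc i) \<le> v i)"

definition shape :: "nat option list \<Rightarrow> nat \<Rightarrow> int" where
  "shape xs = (\<lambda>i. int (count_list xs (Some i)))"

text \<open>The Yamanouchi condition: the entries are then the rows of the labels in a tableau with
  increasing rows and columns.\<close>

definition lattice_word :: "nat option list \<Rightarrow> bool" where
  "lattice_word xs \<longleftrightarrow> (\<forall>i. dominant (shape (take i xs)))"

lemma V_eq:
  assumes "k \<ge> 1"
  shows "V k = {v. dominant v \<and> (\<forall>i\<ge>k. v i = 0)}"
proof (intro set_eqI iffI)
  fix v assume v: "v \<in> V k"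
  have outside: "v i = 0" if "i = 0 \<or> k \<le> i" for i
    using v that assms by (auto simp: V_def)
  have step: "v (Suc i) \<le> v i" if "1 \<le> i" for i
  proof (cases "i < k - 1")
    case False
    then show ?thesis
      using v outside[of "Suc i"] outside[of i] that by (cases "i = k - 1") (auto simp: V_def)
  qed (use v that in \<open>auto simp: V_def\<close>)
  have "0 \<le> v i" for i
  proof (cases "i = 0 \<or> k \<le> i")
    case False
    \<comment> \<open>The inequalities are followed down to index \<open>k\<close>, where the vector
      vanishes.\<close>
    have "v k \<le> v i"
    proof (rule dec_induct[of i k])
      fix j assume "i \<le> j" "v j \<le> v i"
      then show "v (Suc j) \<le> v i"
        using step[of j] False by simp
    qed (use False in auto)
    then show ?thesis
      using outside[of k] by simp
  qed (simp add: outside)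
  then show "v \<in> {v. dominant v \<and> (\<forall>i\<ge>k. v i = 0)}"
    using outside step by (auto simp: dominant_def)
qed (use assms in \<open>auto simp: V_def dominant_def not_le intro: ccontr\<close>)

lemma shape_simps [simp]:
  "shape (replicate m None) = 0"
  "shape (xs @ [None]) = shape xs"
  "shape (xs @ [Some r]) = shape xs + unit_vec r"
  by (auto simp: shape_def unit_vec_def fun_eq_iff count_list_0_iff)

lemma shape_nonneg: "0 \<le> shape xs i"
  by (simp add: shape_def)

lemma dominant_0 [simp]: "dominant 0"
  by (simp add: dominant_def)

lemma lattice_word_replicate_None [simp]: "lattice_word (replicate m None)"
  by (simp add: lattice_word_def)

lemma lattice_word_Nil [simp]: "lattice_word []"
  using lattice_word_replicate_None[of 0] by simp

lemma lattice_word_snoc: "lattice_word (xs @ [x]) \<longleftrightarrow> lattice_word xs \<and> dominant (shape (xs @ [x]))"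
proof (intro iffI conjI)
  assume *: "lattice_word (xs @ [x])"
  then show "dominant (shape (xs @ [x]))"
    unfolding lattice_word_def by (metis order_refl take_all)
  show "lattice_word xs"
    unfolding lattice_word_def
  proof
    fix i show "dominant (shape (take i xs))"
      using *[unfolded lattice_word_def, rule_format, of "min i (length xs)"] by (simp add: min_def split: if_splits)
  qed
next
  assume *: "lattice_word xs \<and> dominant (shape (xs @ [x]))"
  show "lattice_word (xs @ [x])"
    unfolding lattice_word_def
  proof
    fix i show "dominant (shape (take i (xs @ [x])))"
      using * by (cases "i \<le> length xs") (auto simp: lattice_word_def)
  qed
qed

lemma lattice_word_dominant: "lattice_word xs \<Longrightarrow> dominant (shape xs)"
  unfolding lattice_word_def by (metis order_refl take_all)

lemma lattice_word_take: "lattice_word xs \<Longrightarrow> lattice_word (take i xs)"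
  by (simp add: lattice_word_def take_take)

lemma unit_vec_inject [simp]: "unit_vec r = unit_vec s \<longleftrightarrow> r = s"
  by (auto simp: unit_vec_def fun_eq_iff split: if_splits)

lemma unit_vec_nonzero [simp]: "unit_vec r \<noteq> 0"
  by (auto simp: unit_vec_def fun_eq_iff)

lemma shape_place:
  assumes "a < length xs" "xs ! a = None"
  shows "shape (place a xs) = shape xs + unit_vec (new_row a xs)"
  using assms
proof (induction xs rule: rev_induct)
  case (snoc x xs)
  show ?case
  proof (cases "a = length xs")
    case True
    then show ?thesis
      using snoc.prems by simp
  next
    case False
    then have "a < length xs" "xs ! a = None"
      using snoc.prems by (auto simp: nth_append)
    then show ?thesis
      using snoc.IH by (cases x) (auto simp: place_snoc algebra_simps)
  qed
qed simp

text \<open>The forward local rule has two cases: distinct corners, treated here, and equal ones,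
  treated in \<open>dominant_next_row\<close>. The reverse direction uses
  \<open>dominant_meet\<close>.\<close>

lemma dominant_join:
  assumes "dominant (v + unit_vec r)" "dominant (v + unit_vec s)" "r \<noteq> s"
  shows "dominant (v + unit_vec r + unit_vec s)"
  unfolding dominant_def
proof (intro conjI allI impI)
  fix i :: nat
  assume "1 \<le> i"
  then have "v (Suc i) + unit_vec r (Suc i) \<le> v i + unit_vec r i"
    "v (Suc i) + unit_vec s (Suc i) \<le> v i + unit_vec s i"
    using assms by (auto simp: dominant_def)
  then show "(v + unit_vec r + unit_vec s) (Suc i) \<le> (v + unit_vec r + unit_vec s) i"
    using assms(3) by (auto simp: unit_vec_def split: if_splits)
next
  fix i :: nat
  have "0 \<le> v i + unit_vec r i" "0 \<le> unit_vec s i"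
    using assms by (auto simp: dominant_def unit_vec_def)
  then show "0 \<le> (v + unit_vec r + unit_vec s) i"
    by simp
next
  have "v 0 + unit_vec r 0 = 0" "v 0 + unit_vec s 0 = 0"
    using assms by (auto simp: dominant_def)
  then show "(v + unit_vec r + unit_vec s) 0 = 0"
    using assms(3) by (auto simp: unit_vec_def split: if_splits)
qed

text \<open>Row \<open>Suc r\<close> was no longer than row \<open>r\<close>, so it may grow once
  row \<open>r\<close> has grown.\<close>

lemma dominant_next_row:
  assumes "dominant v" "dominant (v + unit_vec r)"
  shows "dominant (v + unit_vec r + unit_vec (Suc r))"
  unfolding dominant_def
proof (intro conjI allI impI)
  fix i :: nat
  assume "1 \<le> i"
  then have "v (Suc i) + unit_vec r (Suc i) \<le> v i + unit_vec r i" "v (Suc i) \<le> v i"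
    using assms by (auto simp: dominant_def)
  then show "(v + unit_vec r + unit_vec (Suc r)) (Suc i) \<le> (v + unit_vec r + unit_vec (Suc r)) i"
    by (auto simp: unit_vec_def split: if_splits)
qed (use assms in \<open>auto simp: dominant_def unit_vec_def split: if_splits\<close>)

lemma dominant_meet:
  assumes "dominant (v + unit_vec r)" "dominant (v + unit_vec s)" "r \<noteq> s"
  shows "dominant v"
  unfolding dominant_def
proof (intro conjI allI impI)
  fix i :: nat
  assume "1 \<le> i"
  then have "v (Suc i) + unit_vec r (Suc i) \<le> v i + unit_vec r i"
    "v (Suc i) + unit_vec s (Suc i) \<le> v i + unit_vec s i"
    using assms by (auto simp: dominant_def)
  then show "v (Suc i) \<le> v i"
    using assms(3) by (auto simp: unit_vec_def split: if_splits)
next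
  fix i :: nat
  have "0 \<le> v i + unit_vec r i" "0 \<le> v i + unit_vec s i"
    using assms by (auto simp: dominant_def)
  then show "0 \<le> v i"
    using assms(3) by (auto simp: unit_vec_def split: if_splits)
next
  have "v 0 + unit_vec r 0 = 0" "v 0 + unit_vec s 0 = 0" "0 \<le> v 0 + unit_vec r 0"
    using assms by (auto simp: dominant_def)
  then show "v 0 = 0"
    using assms(3) by (auto simp: unit_vec_def split: if_splits)
qed

lemma lattice_word_place:
  assumes "a < length xs" "xs ! a = None" "lattice_word xs"
  shows "lattice_word (place a xs)"
  using assms
proof (induction xs rule: rev_induct)
  case (snoc x xs)
  have lat: "lattice_word xs" "dominant (shape xs)" "dominant (shape (xs @ [x]))"
    using snoc.prems(3) lattice_word_dominant by (auto simp: lattice_word_snoc)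
  show ?case
  proof (cases "a = length xs")
    case True
    have "dominant (shape xs + unit_vec 1)"
      using lat(2) by (auto simp: dominant_def unit_vec_def)
    then show ?thesis
      using lat True by (simp add: lattice_word_snoc)
  next
    case False
    then have a: "a < length xs" "xs ! a = None"
      using snoc.prems by (auto simp: nth_append)
    with lat snoc.IH have IH: "lattice_word (place a xs)"
      by simp
    have "dominant (shape xs + unit_vec (new_row a xs))"
      using lattice_word_dominant[OF IH] a by (simp add: shape_place)
    then show ?thesis
      using IH a lat dominant_join[of "shape xs"] dominant_next_row[of "shape xs"]
      by (cases x) (auto simp: place_snoc lattice_word_snoc shape_place)
  qed
qed simp

text \<open>Reverse row insertion, starting from the corner in row \<open>r\<close>.\<close>

lemma place_surj:
  assumes "lattice_word xs" "dominant (shape xs - unit_vec r)" "0 < r"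
  shows "\<exists>a ys. a < length ys \<and> ys ! a = None \<and> lattice_word ys \<and> place a ys = xs \<and> new_row a ys = r"
  using assms
proof (induction xs arbitrary: r rule: rev_induct)
  case Nil
  then show ?case
    by (auto simp: dominant_def shape_def unit_vec_def split: if_splits)
next
  case (snoc x xs)
  have lat: "lattice_word xs" "dominant (shape xs)" "dominant (shape (xs @ [x]))"
    using snoc.prems(1) lattice_word_dominant by (auto simp: lattice_word_snoc)
  \<comment> \<open>Peels off the last label: \<open>s\<close> is the corner to remove from the
    prefix and \<open>y\<close> the entry of the last label before insertion. The equations for
    \<open>x\<close> and \<open>r\<close> are those of \<open>place_snoc\<close>.\<close>
  have extend: ?case if step: "dominant (shape xs - unit_vec s)" "0 < s"
      "x = (if y = Some s then Some (Suc s) else y)" "r = (if y = Some s then Suc s else s)" for s y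
  proof -
    obtain a ys where *: "a < length ys" "ys ! a = None" "lattice_word ys" "place a ys = xs" "new_row a ys = s"
      using snoc.IH[OF lat(1) step(1,2)] by blast
    have pl: "place a (ys @ [y]) = xs @ [x]" "new_row a (ys @ [y]) = r"
      using * step by (simp_all add: place_snoc)
    then have "shape (xs @ [x]) = shape (ys @ [y]) + unit_vec r"
      using shape_place[of a "ys @ [y]"] * by (simp add: nth_append)
    then have "lattice_word (ys @ [y])"
      using snoc.prems(2) *(3) by (simp add: lattice_word_snoc)
    then show ?case
      using pl * by (intro exI[of _ a] exI[of _ "ys @ [y]"]) (simp add: nth_append)
  qed
  show ?case
  proof (cases "x = Some r")
    case True
    show ?thesis
    proof (cases "r = 1")
      \<comment> \<open>Here the last label is itself the inserted one.\<close>
      case r1: True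
      with True lat show ?thesis
        by (intro exI[of _ "length xs"] exI[of _ "xs @ [None]"]) (simp add: lattice_word_snoc)
    next
      case False
      then obtain s where s: "r = Suc s" "0 < s"
        using snoc.prems(3) by (cases r) auto
      \<comment> \<open>The last label was pushed from row \<open>s\<close> to row \<open>r\<close>.
        Row \<open>s\<close> of the prefix is longer than row \<open>r\<close>, since the shape
        stays dominant when row \<open>r\<close> grows.\<close>
      have "dominant (shape xs - unit_vec s)"
        unfolding dominant_def
      proof (intro conjI allI impI)
        fix i :: nat
        assume "1 \<le> i"
        then have "shape xs (Suc i) + unit_vec r (Suc i) \<le> shape xs i + unit_vec r i"
          "shape xs (Suc i) \<le> shape xs i"
          using lat True by (auto simp: dominant_def)
        moreover have "shape xs (Suc r) \<le> shape xs r"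
          using snoc.prems(2,3) lat(2) True by (auto simp: dominant_def)
        ultimately show "(shape xs - unit_vec s) (Suc i) \<le> (shape xs - unit_vec s) i"
          using snoc.prems(2,3) True s by (auto simp: dominant_def unit_vec_def split: if_splits)
      next
        fix i
        have "shape xs r + 1 \<le> shape xs s" "0 \<le> shape xs r" "0 \<le> shape xs i"
          using lat(2,3) True s by (auto simp: dominant_def unit_vec_def split: if_splits)
        then show "0 \<le> (shape xs - unit_vec s) i"
          using s by (auto simp: unit_vec_def)
      qed (use s lat(2) in \<open>auto simp: dominant_def unit_vec_def\<close>)
      then show ?thesis
        using extend[of s "Some s"] s True by simp
    qed
  next
    case False
    \<comment> \<open>Taking away the last label and taking away the corner in row \<open>r\<close>
      are both possible and concern different rows, so they are possible together.\<close>
    have "dominant (shape xs - unit_vec r)"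
    proof (cases x)
      case None
      show ?thesis
        using snoc.prems(2) by (simp only: None shape_simps)
    next
      case (Some s)
      have "shape (xs @ [x]) - unit_vec r = shape xs - unit_vec r + unit_vec s"
        using Some by (simp add: fun_eq_iff)
      with snoc.prems(2) have "dominant (shape xs - unit_vec r + unit_vec s)"
        by (simp only:)
      moreover have "dominant (shape xs - unit_vec r + unit_vec r)"
        using lat(2) by (simp only: diff_add_cancel)
      ultimately show ?thesis
        using False Some dominant_meet by blast
    qed
    then show ?thesis
      using extend[of r x] False snoc.prems(3) by simp
  qed
qed

text \<open>Separates a last label just inserted into row 1 from one that stood there before: the
  new corner lies in row 1 only in the former case.\<close>

lemma place_snoc_neq:
  assumes "b < length zs" "place b (zs @ [y]) = us @ [Some 1]"
  shows "new_row b (zs @ [y]) \<noteq> 1"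
  using assms new_row_pos[of b zs] by (auto simp: place_snoc split: if_splits)

lemma place_inj:
  assumes "place a xs = place b ys" "new_row a xs = new_row b ys"
    "a < length xs" "xs ! a = None" "b < length ys" "ys ! b = None"
  shows "a = b \<and> xs = ys"
  using assms
proof (induction xs arbitrary: ys rule: rev_induct)
  case (snoc x xs)
  have len: "length ys = Suc (length xs)"
    using snoc.prems by (metis length_append_singleton length_place)
  then obtain zs y where ys: "ys = zs @ [y]" "length zs = length xs"
    by (metis length_Suc_conv_rev)
  show ?case
  proof (cases "a = length xs"; cases "b = length zs")
    assume a: "a = length xs" and b: "b = length zs"
    have "x = None" "y = None"
      using snoc.prems(4,6) unfolding a b ys(1) by simp_all
    moreover have "xs @ [Some 1] = zs @ [Some 1]"
      using snoc.prems(1) unfolding a b ys(1) place_last .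
    ultimately show ?thesis
      using ys a b by simp
  next
    assume a: "a = length xs" and b: "b \<noteq> length zs"
    have "x = None"
      using snoc.prems(4) unfolding a by simp
    then show ?thesis
      using snoc.prems(1,2,5) place_snoc_neq[of b zs y xs] b unfolding a ys(1) place_last by simp
  next
    assume a: "a \<noteq> length xs" and b: "b = length zs"
    have "y = None"
      using snoc.prems(6) unfolding b ys(1) by simp
    then show ?thesis
      using snoc.prems(1,2,3) place_snoc_neq[of a xs x zs] a unfolding b ys(1) place_last by simp
  next
    assume "a \<noteq> length xs" "b \<noteq> length zs"
    then have ab: "a < length xs" "b < length zs"
      using snoc.prems(3,5) ys(1) by auto
    then have nth: "xs ! a = None" "zs ! b = None"
      using snoc.prems(4,6) ys(1) by (auto simp: nth_append)
    have eq: "place a xs = place b zs"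
      "(if x = Some (new_row a xs) then Some (Suc (new_row a xs)) else x) =
       (if y = Some (new_row b zs) then Some (Suc (new_row b zs)) else y)"
      "(if x = Some (new_row a xs) then Suc (new_row a xs) else new_row a xs) =
       (if y = Some (new_row b zs) then Suc (new_row b zs) else new_row b zs)"
      using snoc.prems(1,2) unfolding ys(1) place_snoc[OF ab(1)] place_snoc[OF ab(2)] by simp_all
    \<comment> \<open>The local rule is injective: the entry was bumped exactly when the resulting
      entry and the resulting corner have the same row.\<close>
    then have "new_row a xs = new_row b zs" "x = y"
      by (auto split: if_splits)
    then show ?thesis
      using snoc.IH[OF eq(1) _ ab(1) nth(1) ab(2) nth(2)] ys(1) by simp
  qed
qed simp

section \<open>Choice sequences and walks\<close>

text \<open>A list of choices records, for the last \<open>length cs\<close> elements of \<open>{1..n}\<close>, the opener of the arc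
  that closes there. Its head belongs to the smallest of these elements, which is processed last.
  Choices and lattice words are indexed from 0, so \<open>Some a\<close> refers to the element \<open>a + 1\<close>.\<close>

fun apply_choice :: "nat option \<Rightarrow> nat option list \<Rightarrow> nat option list" where
  "apply_choice None xs = xs"
| "apply_choice (Some a) xs = place a xs"

fun choice_ok :: "nat option \<Rightarrow> nat option list \<Rightarrow> bool" where
  "choice_ok None xs \<longleftrightarrow> True"
| "choice_ok (Some a) xs \<longleftrightarrow> a < length xs \<and> xs ! a = None"

text \<open>At each element \<open>butlast\<close> first removes its label, so that it acts as an
  opener; the choice then lets the same element close an arc.\<close>

fun state :: "nat \<Rightarrow> nat option list \<Rightarrow> nat option list" where
  "state n [] = replicate n None"
| "state n (c # cs) = apply_choice c (butlast (state n cs))"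

fun legal :: "nat \<Rightarrow> nat option list \<Rightarrow> bool" where
  "legal n [] \<longleftrightarrow> True"
| "legal n (c # cs) \<longleftrightarrow> legal n cs \<and> length cs < n \<and> choice_ok c (butlast (state n cs))"

definition rows_less :: "nat \<Rightarrow> nat option list \<Rightarrow> bool" where
  "rows_less k xs \<longleftrightarrow> (\<forall>r. Some r \<in> set xs \<longrightarrow> r < k)"

text \<open>The latest shape comes first, so the list is the walk in the order of increasing
  elements, each element giving a down step and then an up step.\<close>

fun shapes :: "nat \<Rightarrow> nat option list \<Rightarrow> (nat \<Rightarrow> int) list" where
  "shapes n [] = [0]"
| "shapes n (c # cs) = shape (state n (c # cs)) # shape (butlast (state n cs)) # shapes n cs"

definition bounded :: "nat \<Rightarrow> nat \<Rightarrow> nat option list \<Rightarrow> bool" where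
  "bounded k n cs \<longleftrightarrow> (\<forall>i\<le>length cs. rows_less k (state n (drop i cs)))"

lemma length_apply_choice [simp]: "choice_ok c xs \<Longrightarrow> length (apply_choice c xs) = length xs"
  by (cases c) auto

lemma lattice_word_apply_choice:
  "choice_ok c xs \<Longrightarrow> lattice_word xs \<Longrightarrow> lattice_word (apply_choice c xs)"
  by (cases c) (auto simp: lattice_word_place)

lemma lattice_word_butlast: "lattice_word xs \<Longrightarrow> lattice_word (butlast xs)"
  by (simp add: butlast_conv_take lattice_word_take)

lemma state_props:
  "legal n cs \<Longrightarrow> length (state n cs) = n - length cs \<and> lattice_word (state n cs)"
  by (induction cs) (auto simp: lattice_word_apply_choice lattice_word_butlast)

lemma length_shapes [simp]: "length (shapes n cs) = 2 * length cs + 1"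
  by (induction cs) auto

lemma hd_shapes: "hd (shapes n cs) = shape (state n cs)"
  by (cases cs) auto

lemma shape_eq_0_iff: "shape xs i = 0 \<longleftrightarrow> Some i \<notin> set xs"
  by (simp add: shape_def count_list_0_iff)

lemma rows_less_iff: "rows_less k xs \<longleftrightarrow> (\<forall>i\<ge>k. shape xs i = 0)"
  by (auto simp: rows_less_def shape_eq_0_iff not_le[symmetric])

lemma shape_in_V_iff:
  assumes "k \<ge> 1" "lattice_word xs"
  shows "shape xs \<in> V k \<longleftrightarrow> rows_less k xs"
  using assms lattice_word_dominant by (auto simp: V_eq rows_less_iff)

lemma rows_less_butlast: "rows_less k xs \<Longrightarrow> rows_less k (butlast xs)"
  by (auto simp: rows_less_def dest: in_set_butlastD)

lemma bounded_Nil [simp]: "bounded k n []"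
  by (simp add: bounded_def rows_less_def)

lemma bounded_Cons: "bounded k n (c # cs) \<longleftrightarrow> rows_less k (state n (c # cs)) \<and> bounded k n cs"
proof -
  have "(\<forall>i\<le>Suc m. P i) \<longleftrightarrow> P 0 \<and> (\<forall>i\<le>m. P (Suc i))" for m P
    by (metis Suc_le_mono le0 old.nat.exhaust)
  then show ?thesis
    unfolding bounded_def by (simp del: state.simps)
qed

section \<open>Walks built from pairs of steps\<close>

definition up :: "nat \<Rightarrow> (nat \<Rightarrow> int) set" where
  "up k = {0} \<union> unit_vec ` {1..k-1}"

text \<open>Only the end is pinned to 0; the start stays free for inductions that peel off two
  steps.\<close>

inductive walk :: "nat \<Rightarrow> (nat \<Rightarrow> int) list \<Rightarrow> bool" for k where
  "walk k [0]"
| "walk k v \<Longrightarrow> a \<in> V k \<Longrightarrow> b \<in> V k \<Longrightarrow> a - b \<in> up k \<Longrightarrow> hd v - b \<in> up k \<Longrightarrow> walk k (a # b # v)"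

lemma zero_in_V: "0 \<in> V k"
  by (simp add: V_def)

lemma up_iff: "v \<in> up k \<longleftrightarrow> v = 0 \<or> (\<exists>r. 0 < r \<and> r < k \<and> v = unit_vec r)"
  by (auto simp: up_def)

lemma minus_in_up_iff:
  "x - y \<in> {0} \<union> (\<lambda>i. - unit_vec i) ` {1..k-1} \<longleftrightarrow> y - x \<in> up k"
proof -
  have "x - y = - u \<longleftrightarrow> y - x = u" for u
    by (metis minus_diff_eq neg_equal_iff_equal)
  moreover have "x - y = 0 \<longleftrightarrow> y - x = 0"
    by (metis eq_iff_diff_eq_0)
  ultimately show ?thesis
    unfolding up_def Un_iff image_iff singleton_iff by metis
qed

inductive_simps walk_single: "walk k [a]"
inductive_simps walk_Cons2: "walk k (a # b # v)"

lemma walk_hd_in_V: "walk k v \<Longrightarrow> hd v \<in> V k"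
  by (induction rule: walk.induct) (simp_all only: list.sel zero_in_V)

lemma walk_iff:
  "length v = 2 * n + 1 \<Longrightarrow> walk k v \<longleftrightarrow> set v \<subseteq> V k \<and> v ! (2 * n) = 0 \<and>
    (\<forall>m<2 * n. even m \<longrightarrow> v ! m - v ! Suc m \<in> up k) \<and> (\<forall>m<2 * n. odd m \<longrightarrow> v ! Suc m - v ! m \<in> up k)"
proof (induction n arbitrary: v)
  case 0
  then obtain a where "v = [a]"
    by (auto simp: length_Suc_conv)
  then show ?case
    using zero_in_V[of k] by (cases "a = 0") (simp_all add: walk_single zero_fun_def)
next
  case (Suc n)
  then obtain a b w where v: "v = a # b # w" "length w = 2 * n + 1"
    by (auto simp: length_Suc_conv)
  have shift: "(\<forall>m<2 * Suc n. P m) \<longleftrightarrow> P 0 \<and> P 1 \<and> (\<forall>m<2 * n. P (Suc (Suc m)))" for P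
    by (simp add: All_less_Suc2)
  have hd: "hd w = w ! 0"
    using v(2) by (simp add: hd_conv_nth flip: length_greater_0_conv)
  show ?case
    unfolding shift v(1) walk_Cons2 Suc.IH[OF v(2)] by (auto simp: hd)
qed

lemma walks_eq: "walks k n = {v. length v = 2 * n + 1 \<and> walk k v \<and> hd v = 0}"
proof (rule set_eqI)
  fix v :: "(nat \<Rightarrow> int) list"
  show "v \<in> walks k n \<longleftrightarrow> v \<in> {v. length v = 2 * n + 1 \<and> walk k v \<and> hd v = 0}"
  proof (cases "length v = 2 * n + 1")
    case True
    then have "hd v = v ! 0"
      by (simp add: hd_conv_nth flip: length_greater_0_conv)
    moreover have "(\<forall>m<2 * n. v ! (m + 1) - v ! m \<in> {0} \<union> unit_vec ` {1..k-1} \<union> (\<lambda>i. - unit_vec i) ` {1..k-1}) \<and>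
     (\<forall>m<2 * n. even m \<longrightarrow> v ! (m + 1) - v ! m \<in> {0} \<union> (\<lambda>i. - unit_vec i) ` {1..k-1}) \<and>
     (\<forall>m<2 * n. odd m \<longrightarrow> v ! (m + 1) - v ! m \<in> {0} \<union> unit_vec ` {1..k-1}) \<longleftrightarrow>
     (\<forall>m<2 * n. even m \<longrightarrow> v ! (m + 1) - v ! m \<in> {0} \<union> (\<lambda>i. - unit_vec i) ` {1..k-1}) \<and>
     (\<forall>m<2 * n. odd m \<longrightarrow> v ! (m + 1) - v ! m \<in> {0} \<union> unit_vec ` {1..k-1})"
      by blast
    ultimately show ?thesis
      using True walk_iff[OF True, of k]
      unfolding walks_def minus_in_up_iff up_def[symmetric] mem_Collect_eq Suc_eq_plus1[symmetric]
      by metis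
  qed (simp add: walks_def)
qed

lemma butlast_snoc_cases:
  assumes "xs \<noteq> []"
  obtains x where "xs = butlast xs @ [x]"
  using assms by (metis append_butlast_last_id)

lemma shape_snoc_diff:
  assumes "lattice_word (xs @ [x])" "rows_less k (xs @ [x])"
  shows "shape (xs @ [x]) - shape xs \<in> up k"
proof (cases x)
  case (Some r)
  \<comment> \<open>A label in row 0 would make coordinate 0 of the shape nonzero.\<close>
  have "0 < r"
    using lattice_word_dominant[OF assms(1)] shape_nonneg[of xs 0] Some
    by (cases "r = 0") (auto simp: dominant_def unit_vec_def)
  moreover have "r < k"
    using assms(2) Some by (simp add: rows_less_def)
  ultimately show ?thesis
    using Some by (auto simp: up_iff)
qed (simp add: up_iff)

lemma shape_apply_choice_diff:
  assumes "choice_ok c xs" "rows_less k (apply_choice c xs)"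
  shows "shape (apply_choice c xs) - shape xs \<in> up k"
proof (cases c)
  case (Some a)
  then have shape: "shape (place a xs) = shape xs + unit_vec (new_row a xs)"
    using assms(1) shape_place by simp
  have "shape (place a xs) (new_row a xs) \<noteq> 0"
    using shape_nonneg[of xs "new_row a xs"] by (simp add: shape unit_vec_def)
  then have "new_row a xs < k"
    using assms(2) Some by (auto simp: rows_less_iff not_le[symmetric])
  then show ?thesis
    using Some shape new_row_pos by (auto simp: up_iff)
qed (simp add: up_iff)

lemma walk_shapes:
  assumes "k \<ge> 1"
  shows "legal n cs \<Longrightarrow> bounded k n cs \<Longrightarrow> walk k (shapes n cs)"
proof (induction cs)
  case Nil
  then show ?case
    by (simp add: walk_single)
next
  case (Cons c cs)
  have legal: "legal n cs" "choice_ok c (butlast (state n cs))" "length cs < n"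
    and bounded: "rows_less k (state n (c # cs))" "bounded k n cs"
    using Cons.prems by (auto simp: bounded_Cons)
  have rows: "rows_less k (state n cs)"
    using bounded(2) unfolding bounded_def by (metis drop0 le0)
  have state: "lattice_word (state n cs)" "lattice_word (state n (c # cs))" "state n cs \<noteq> []"
    using state_props[OF legal(1)] state_props[OF Cons.prems(1)] legal(3) by auto
  obtain x where x: "state n cs = butlast (state n cs) @ [x]"
    using state(3) by (rule butlast_snoc_cases)
  show ?case
    unfolding shapes.simps
  proof (rule walk.intros(2))
    show "walk k (shapes n cs)"
      using Cons.IH legal bounded by simp
    show "shape (state n (c # cs)) \<in> V k"
      using assms state bounded by (simp add: shape_in_V_iff del: state.simps)
    show "shape (butlast (state n cs)) \<in> V k"
      using assms state rows by (simp add: shape_in_V_iff lattice_word_butlast rows_less_butlast)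
    show "shape (state n (c # cs)) - shape (butlast (state n cs)) \<in> up k"
      using shape_apply_choice_diff[OF legal(2)] bounded(1) by simp
    show "hd (shapes n cs) - shape (butlast (state n cs)) \<in> up k"
      using shape_snoc_diff[of "butlast (state n cs)" x k] state(1) rows unfolding x[symmetric] hd_shapes .
  qed
qed

text \<open>The change of shape tells whether an arc was closed and in which row the corner
  appeared, so \<open>place_inj\<close> applies.\<close>

lemma apply_choice_inj:
  assumes "choice_ok c xs" "choice_ok d ys" "apply_choice c xs = apply_choice d ys" "shape xs = shape ys"
  shows "c = d \<and> xs = ys"
proof -
  have shape: "shape (place a zs) = shape zs + unit_vec (new_row a zs)" if "choice_ok (Some a) zs" for a zs
    using that shape_place by simp
  show ?thesis
  proof (cases c; cases d)
    fix a b
    assume cd: "c = Some a" "d = Some b"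
    have "shape xs + unit_vec (new_row a xs) = shape ys + unit_vec (new_row b ys)"
      using shape[of a xs] shape[of b ys] assms cd by simp
    then have "new_row a xs = new_row b ys"
      using assms(4) by simp
    then show ?thesis
      using place_inj[of a xs b ys] assms cd by simp
  next
    fix a
    assume cd: "c = None" "d = Some a"
    then have "shape ys = shape ys + unit_vec (new_row a ys)"
      using shape[of a ys] assms by simp
    then show ?thesis
      by simp
  next
    fix a
    assume cd: "c = Some a" "d = None"
    then have "shape xs = shape xs + unit_vec (new_row a xs)"
      using shape[of a xs] assms by simp
    then show ?thesis
      by simp
  qed (use assms in auto)
qed

lemma shape_snoc_inj:
  assumes "shape (xs @ [x]) = shape (xs @ [y])"
  shows "x = y"
  using assms by (cases x; cases y) simp_all

text \<open>Undoes the steps from the head of the list: the current word and the known shapes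
  determine the last choice and then the entry deleted before it.\<close>

lemma shapes_inj:
  "legal n cs \<Longrightarrow> legal n ds \<Longrightarrow> state n cs = state n ds \<Longrightarrow> shapes n cs = shapes n ds \<Longrightarrow> cs = ds"
proof (induction cs arbitrary: ds)
  case Nil
  then show ?case
    by (cases ds) auto
next
  case (Cons c cs)
  then obtain d es where ds: "ds = d # es"
    by (cases ds) auto
  have shapes: "shape (butlast (state n cs)) = shape (butlast (state n es))" "shapes n cs = shapes n es"
    using Cons.prems(4) unfolding ds shapes.simps list.inject by blast+
  have 1: "c = d \<and> butlast (state n cs) = butlast (state n es)"
    using Cons.prems(1-3) shapes(1) unfolding ds by (intro apply_choice_inj) simp_all
  have "state n cs \<noteq> []" "state n es \<noteq> []"
    using Cons.prems state_props[of n cs] state_props[of n es] ds by auto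
  then obtain x y where xy: "state n cs = butlast (state n cs) @ [x]" "state n es = butlast (state n es) @ [y]"
    by (metis butlast_snoc_cases)
  have "shape (state n cs) = shape (state n es)"
    using shapes(2) hd_shapes by metis
  then have "x = y"
    using xy 1 shape_snoc_inj by metis
  then have "state n cs = state n es"
    using xy 1 by metis
  then show ?case
    using Cons.IH[of es] Cons.prems ds 1 shapes(2) by simp
qed

lemma choice_exists:
  assumes "lattice_word xs" "dominant b" "shape xs - b \<in> up k"
  obtains c ys where "choice_ok c ys" "lattice_word ys" "apply_choice c ys = xs" "shape ys = b"
proof (cases "shape xs = b")
  case True
  then show ?thesis
    using assms that[of None xs] by simp
next
  case False
  then have "shape xs - b \<noteq> 0"
    by (simp only: right_minus_eq not_False_eq_True)
  then obtain r where r: "0 < r" "shape xs - b = unit_vec r"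
    using assms(3) up_iff by blast
  then have b: "b = shape xs - unit_vec r"
    by (metis diff_diff_eq2 add_diff_cancel_left')
  obtain a ys where *: "a < length ys" "ys ! a = None" "lattice_word ys" "place a ys = xs" "new_row a ys = r"
    using place_surj[OF assms(1) _ r(1)] assms(2) unfolding b by blast
  then have "shape xs = shape ys + unit_vec r"
    using shape_place by blast
  then have "shape ys = b"
    unfolding b by (metis add_diff_cancel_right')
  then show ?thesis
    using * that[of "Some a" ys] by simp
qed

text \<open>Follows the walk from its start, undoing one choice and one deletion for every two
  steps, from any lattice word \<open>xs\<close> of the starting shape. At the end the shape is 0,
  so no label is open.\<close>

lemma walk_is_shapes:
  assumes "k \<ge> 1"
  shows "walk k v \<Longrightarrow> length v = 2 * m + 1 \<Longrightarrow> m \<le> n \<Longrightarrow> lattice_word xs \<Longrightarrow> length xs = n - m \<Longrightarrow>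
    shape xs = hd v \<Longrightarrow> \<exists>cs. legal n cs \<and> bounded k n cs \<and> state n cs = xs \<and> shapes n cs = v"
proof (induction arbitrary: m xs rule: walk.induct)
  case 1
  then have "m = 0" "\<forall>x\<in>set xs. x = None"
    using shape_eq_0_iff[of xs] by (auto, metis not_Some_eq)
  then have "xs = replicate n None"
    using 1 by (simp add: replicate_eqI)
  then show ?case
    by (intro exI[of _ "[]"]) simp
next
  case (2 v a b)
  then obtain m' where m: "m = Suc m'" "length v = 2 * m' + 1"
    by (cases m) auto
  have dom: "dominant b" "dominant (hd v)"
    using 2 walk_hd_in_V[of k v] assms by (auto simp: V_eq)
  obtain c ys where c: "choice_ok c ys" "lattice_word ys" "apply_choice c ys = xs" "shape ys = b"
    using choice_exists[of xs b k] 2 dom by auto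
  have len: "length ys = length xs"
    using c by auto
  \<comment> \<open>The deleted entry is \<open>None\<close> for a zero step and otherwise the row
    in which the shape grows.\<close>
  obtain x where x: "shape (ys @ [x]) = hd v"
  proof (cases "hd v - b = 0")
    case True
    then have "shape (ys @ [None]) = hd v"
      using c(4) by (simp only: right_minus_eq shape_simps)
    then show ?thesis
      using that by blast
  next
    case False
    then obtain r where "hd v - b = unit_vec r"
      using 2 up_iff by blast
    then have "shape (ys @ [Some r]) = hd v"
      using c(4) by (metis shape_simps(3) add.commute diff_add_cancel)
    then show ?thesis
      using that by blast
  qed
  have lat: "lattice_word (ys @ [x])"
    using c(2) x dom(2) by (simp only: lattice_word_snoc)
  obtain cs where cs: "legal n cs" "bounded k n cs" "state n cs = ys @ [x]" "shapes n cs = v"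
    using "2.IH"[OF m(2) _ lat _ x] "2.prems" m(1) len by fastforce
  have "length cs = m'"
    using m(2) cs(4) by auto
  moreover have "rows_less k xs"
    using shape_in_V_iff[OF assms, of xs] 2 by simp
  ultimately show ?case
    using cs c 2 m by (intro exI[of _ "c # cs"]) (simp add: bounded_Cons)
qed

lemma bij_betw_shapes:
  assumes "k \<ge> 1"
  shows "bij_betw (shapes n) {cs. length cs = n \<and> legal n cs \<and> bounded k n cs} (walks k n)"
  unfolding bij_betw_def
proof (intro conjI inj_onI set_eqI iffI)
  have state_Nil: "state n cs = []" if "length cs = n" "legal n cs" for cs
    using state_props[OF that(2)] that(1) by simp
  {
    fix cs ds
    assume "cs \<in> {cs. length cs = n \<and> legal n cs \<and> bounded k n cs}"
      "ds \<in> {cs. length cs = n \<and> legal n cs \<and> bounded k n cs}" "shapes n cs = shapes n ds"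
    then show "cs = ds"
      using shapes_inj[of n cs ds] state_Nil by auto
  next
    fix v
    assume "v \<in> shapes n ` {cs. length cs = n \<and> legal n cs \<and> bounded k n cs}"
    then show "v \<in> walks k n"
      using walk_shapes[OF assms] shape_simps(1)[of 0] state_Nil by (auto simp: walks_eq hd_shapes)
  next
    fix v
    assume "v \<in> walks k n"
    then have v: "length v = 2 * n + 1" "walk k v" "shape [] = hd v"
      using shape_simps(1)[of 0] by (auto simp: walks_eq)
    then obtain cs where cs: "legal n cs" "bounded k n cs" "shapes n cs = v"
      using walk_is_shapes[OF assms, of v n n "[]"] by auto
    moreover have "length cs = n"
      using cs(3) v(1) by auto
    ultimately show "v \<in> shapes n ` {cs. length cs = n \<and> legal n cs \<and> bounded k n cs}"
      by blast
  }
qed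

section \<open>Crossings\<close>

text \<open>Openers are confined to an interval but not compared with closers; that comparison is
  supplied later by restricting \<open>A\<close> to closers beyond the interval.\<close>

definition crossing :: "(nat \<times> nat) set \<Rightarrow> nat \<Rightarrow> nat \<Rightarrow> nat \<Rightarrow> bool" where
  "crossing A x y m \<longleftrightarrow> (\<exists>as bs. length as = m \<and> length bs = m \<and> sorted_wrt (<) as \<and> sorted_wrt (<) bs \<and>
     set as \<subseteq> {x..<y} \<and> set (zip as bs) \<subseteq> A)"

lemma crossing_0 [simp]: "crossing A x y 0"
  by (simp add: crossing_def)

lemma in_set_zipD:
  assumes "length as = length bs"
  shows "a \<in> set as \<Longrightarrow> \<exists>b. (a, b) \<in> set (zip as bs)"
    and "b \<in> set bs \<Longrightarrow> \<exists>a. (a, b) \<in> set (zip as bs)"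
  using in_set_impl_in_set_zip1[OF assms] in_set_impl_in_set_zip2[OF assms] by metis+

text \<open>An arc whose closer precedes all others can only be the first arc of a crossing, and the
  remaining openers then lie above \<open>a\<close>.\<close>

lemma crossing_insert:
  assumes "\<forall>(a', b')\<in>A. b < b'"
  shows "crossing (insert (a, b) A) x y (Suc m) \<longleftrightarrow>
    crossing A x y (Suc m) \<or> x \<le> a \<and> a < y \<and> crossing A (Suc a) y m"
proof
  assume "crossing (insert (a, b) A) x y (Suc m)"
  then obtain a0 as b0 bs where *: "length as = m" "length bs = m"
      "sorted_wrt (<) (a0 # as)" "sorted_wrt (<) (b0 # bs)" "set (a0 # as) \<subseteq> {x..<y}"
      "(a0, b0) \<in> insert (a, b) A" "set (zip as bs) \<subseteq> insert (a, b) A"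
    unfolding crossing_def by (auto simp: length_Suc_conv)
  have "b \<le> b0"
    using *(6) assms by auto
  then have "b < b'" if "b' \<in> set bs" for b'
    using *(4) that by auto
  then have zip: "set (zip as bs) \<subseteq> A"
    using *(7) by (auto dest: set_zip_rightD)
  show "crossing A x y (Suc m) \<or> x \<le> a \<and> a < y \<and> crossing A (Suc a) y m"
  proof (cases "(a0, b0) = (a, b)")
    case True
    then have "set as \<subseteq> {Suc a..<y}"
      using *(3,5) by force
    moreover have "sorted_wrt (<) as" "sorted_wrt (<) bs"
      using *(3,4) by simp_all
    ultimately have "crossing A (Suc a) y m"
      unfolding crossing_def using *(1,2) zip by blast
    then show ?thesis
      using True * by auto
  next
    case False
    then have "crossing A x y (Suc m)"
      unfolding crossing_def using * zip by (intro exI[of _ "a0 # as"] exI[of _ "b0 # bs"]) auto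
    then show ?thesis ..
  qed
next
  assume "crossing A x y (Suc m) \<or> x \<le> a \<and> a < y \<and> crossing A (Suc a) y m"
  then show "crossing (insert (a, b) A) x y (Suc m)"
  proof
    assume "crossing A x y (Suc m)"
    then show ?thesis
      unfolding crossing_def by blast
  next
    assume *: "x \<le> a \<and> a < y \<and> crossing A (Suc a) y m"
    then obtain as bs where **: "length as = m" "length bs = m" "sorted_wrt (<) as" "sorted_wrt (<) bs"
        "set as \<subseteq> {Suc a..<y}" "set (zip as bs) \<subseteq> A"
      unfolding crossing_def by blast
    have "b < b'" if "b' \<in> set bs" for b'
      using in_set_zipD(2)[of as bs b'] that **(1,2,6) assms by fastforce
    then have "sorted_wrt (<) (b # bs)"
      using **(4) by simp
    moreover have "sorted_wrt (<) (a # as)" "set (a # as) \<subseteq> {x..<y}"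
      using **(3,5) * by force+
    moreover have "set (zip (a # as) (b # bs)) \<subseteq> insert (a, b) A"
      using **(6) by auto
    moreover have "length (a # as) = Suc m" "length (b # bs) = Suc m"
      using **(1,2) by simp_all
    ultimately show ?thesis
      unfolding crossing_def by blast
  qed
qed

text \<open>Position \<open>j\<close> of the list stands for the closer
  \<open>n - length cs + j + 1\<close>; openers are likewise shifted from indices starting at 0 to
  elements starting at 1.\<close>

definition arc_set :: "nat \<Rightarrow> nat option list \<Rightarrow> (nat \<times> nat) set" where
  "arc_set n cs = {(Suc a, Suc (n - length cs + j)) | a j. j < length cs \<and> cs ! j = Some a}"

lemma arc_set_Nil [simp]: "arc_set n [] = {}"
  by (simp add: arc_set_def)

lemma arc_set_iff:
  "(x, y) \<in> arc_set n cs \<longleftrightarrow> 0 < x \<and> (\<exists>j<length cs. cs ! j = Some (x - 1) \<and> y = Suc (n - length cs + j))"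
  by (cases x) (auto simp: arc_set_def)

lemma arc_set_Cons:
  assumes "length cs < n"
  shows "arc_set n (c # cs) =
    (case c of None \<Rightarrow> arc_set n cs | Some a \<Rightarrow> insert (Suc a, n - length cs) (arc_set n cs))"
proof -
  have "Suc (n - Suc (length cs) + j) = n - length cs + j" for j
    using assms by simp
  then have "(x, y) \<in> arc_set n (c # cs) \<longleftrightarrow>
      0 < x \<and> c = Some (x - 1) \<and> y = n - length cs \<or> (x, y) \<in> arc_set n cs" for x y
    unfolding arc_set_iff by (auto simp: Ex_less_Suc2)
  then show ?thesis
    by (auto split: option.split)
qed

lemma arc_set_greater:
  assumes "(a, b) \<in> arc_set n cs"
  shows "n - length cs < b"
  using assms by (auto simp: arc_set_def)

lemma lis_None: "lis c (us @ None # vs) = lis c (us @ vs)"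
  by (induction c us rule: lis.induct) auto

lemma take_place_le: "a < length xs \<Longrightarrow> y \<le> a \<Longrightarrow> take y (place a xs) = take y xs"
  by (simp add: place_def)

lemma take_place_greater:
  assumes "a < length xs" "a < y"
  shows "take y (place a xs) = place a (take y xs)"
proof -
  from assms(2) obtain d where "y = Suc (a + d)"
    using less_imp_Suc_add by blast
  then show ?thesis
    using assms(1) by (simp add: place_def take_bump drop_take)
qed

text \<open>\<open>lis_insert\<close> for the labels in an interval. If \<open>a\<close> lies beyond
  the interval, nothing in it changes; if \<open>a\<close> lies below, the interval is merely bumped
  from some positive row, which leaves \<open>lis 1\<close> unchanged by
  \<open>lis_bump\<close>.\<close>

lemma lis_drop_take_place:
  assumes "a < length xs" "xs ! a = None"
  shows "lis 1 (drop x (take y (place a xs))) =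
    (if x \<le> a \<and> a < y then max (lis 1 (drop x (take y xs))) (Suc (lis 1 (drop (Suc a) (take y xs))))
     else lis 1 (drop x (take y xs)))"
proof (cases "a < y")
  case True
  define us where "us = take y xs"
  have us: "a < length us" "us ! a = None"
    using True assms by (auto simp: us_def)
  have take: "take y (place a xs) = place a us"
    using True assms(1) by (simp add: take_place_greater us_def)
  show ?thesis
  proof (cases "x \<le> a")
    case x: True
    have "drop x us = drop x (take a us) @ None # drop (Suc a) us"
      using us x by (subst id_take_nth_drop[of a us]) auto
    moreover have "drop x (place a us) = drop x (take a us) @ Some 1 # bump 1 (drop (Suc a) us)"
      using us x by (simp add: place_def)
    ultimately show ?thesis
      using x True lis_insert[of "drop x (take a us)" "drop (Suc a) us"] lis_None[of 1]
      unfolding take by (simp add: us_def[symmetric])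
  next
    case x: False
    then obtain d where d: "x = Suc (a + d)"
      using less_imp_Suc_add not_le by blast
    have "drop x (place a us) = bump (carry 1 (take d (drop (Suc a) us))) (drop x us)"
      using us by (simp add: place_def d drop_bump add.commute)
    then show ?thesis
      using x lis_bump[OF carry_ge] unfolding take by (simp add: us_def[symmetric])
  qed
qed (use assms take_place_le in auto)

text \<open>Schensted's theorem for all intervals of openers at once, which makes the induction work.\<close>

lemma crossing_arc_set_iff:
  "legal n cs \<Longrightarrow> y \<le> n - length cs \<Longrightarrow>
    crossing (arc_set n cs) (Suc x) (Suc y) m \<longleftrightarrow> m \<le> lis 1 (drop x (take y (state n cs)))"
proof (induction cs arbitrary: x y m)
  case Nil
  have "lis c (replicate l None) = 0" for c l
    by (induction l) auto
  then show ?case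
    by (cases m) (auto simp: crossing_def length_Suc_conv)
next
  case (Cons c cs)
  then have legal: "legal n cs" "length cs < n" "choice_ok c (butlast (state n cs))"
    by auto
  have y: "y \<le> n - Suc (length cs)"
    using Cons.prems by simp
  have len: "length (butlast (state n cs)) = n - Suc (length cs)"
    using state_props[OF legal(1)] by simp
  \<comment> \<open>The bound on \<open>y\<close> keeps the deleted last label outside the
    interval.\<close>
  have take: "take y (butlast (state n cs)) = take y (state n cs)"
    using y state_props[OF legal(1)] by (simp add: butlast_conv_take min_def)
  have IH: "crossing (arc_set n cs) (Suc x) (Suc y) m \<longleftrightarrow> m \<le> lis 1 (drop x (take y (state n cs)))" for x m
    using Cons.IH[OF legal(1)] y by simp
  show ?case
  proof (cases c)
    case None
    then show ?thesis
      using legal IH take by (simp add: arc_set_Cons)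
  next
    case (Some a)
    have above: "\<forall>(a', b')\<in>arc_set n cs. n - length cs < b'"
      using arc_set_greater by blast
    show ?thesis
    proof (cases m)
      case (Suc l)
      have "crossing (arc_set n (c # cs)) (Suc x) (Suc y) m \<longleftrightarrow>
          m \<le> lis 1 (drop x (take y (state n cs))) \<or>
          x \<le> a \<and> a < y \<and> l \<le> lis 1 (drop (Suc a) (take y (state n cs)))"
        using crossing_insert[OF above, of "Suc a" "Suc x" "Suc y" l] IH[of x m] IH[of "Suc a" l] Some legal Suc
        by (simp add: arc_set_Cons)
      also have "\<dots> \<longleftrightarrow> m \<le> lis 1 (drop x (take y (state n (c # cs))))"
        using lis_drop_take_place[of a "butlast (state n cs)" x y] legal(3) Some Suc take
        by (auto simp: le_max_iff_disj)
      finally show ?thesis .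
    qed simp
  qed
qed

section \<open>The number of rows as the length of an increasing subsequence\<close>

lemma lis_le_rows: "rows_less k xs \<Longrightarrow> lis c xs \<le> k - c"
proof (induction c xs rule: lis.induct)
  case (3 c r xs)
  then have "r < k" "rows_less k xs"
    by (auto simp: rows_less_def)
  then show ?case
    using 3 by auto
qed (auto simp: rows_less_def)

text \<open>In a lattice word a label in row \<open>r + 1\<close> is preceded by one in row
  \<open>r\<close>, so the rows from \<open>c\<close> to \<open>r\<close> occur in increasing order.
  The tail \<open>ws\<close> absorbs what follows as the induction moves to shorter
  prefixes.\<close>

lemma lis_lattice_ge:
  assumes "lattice_word us" "Some r \<in> set us" "1 \<le> c" "c \<le> r"
  shows "Suc r - c + lis (Suc r) ws \<le> lis c (us @ ws)"
  using assms(4,1,2)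
proof (induction r arbitrary: us ws rule: dec_induct)
  case base
  then obtain p q where us: "us = p @ Some c # q"
    by (meson split_list)
  show ?case
    using lis_append_ge[of c "Some c # q @ ws" p] lis_append_ge[of "Suc c" ws q] us by auto
next
  case (step r)
  then obtain p q where us: "us = p @ Some (Suc r) # q"
    by (meson split_list)
  have p: "lattice_word p" "dominant (shape (p @ [Some (Suc r)]))"
    using lattice_word_take[OF step.prems(1), of "Suc (length p)"] us by (simp_all add: lattice_word_snoc)
  have "shape p (Suc r) + 1 \<le> shape p r"
    using p(2) step.hyps assms(3) unfolding dominant_def shape_simps by (auto simp: unit_vec_def dest!: spec[of _ r])
  then have "Some r \<in> set p"
    using shape_eq_0_iff[of p r] shape_nonneg[of p "Suc r"] by auto
  then have "Suc r - c + lis (Suc r) (Some (Suc r) # q @ ws) \<le> lis c (p @ Some (Suc r) # q @ ws)"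
    using step.IH p(1) by blast
  then show ?case
    using lis_append_ge[of "Suc (Suc r)" ws q] us step.hyps by auto
qed

lemma rows_less_iff_lis:
  assumes "lattice_word xs" "k \<ge> 1"
  shows "rows_less k xs \<longleftrightarrow> lis 1 xs < k"
proof
  assume "rows_less k xs"
  then show "lis 1 xs < k"
    using lis_le_rows[of k xs 1] assms(2) by auto
next
  assume *: "lis 1 xs < k"
  show "rows_less k xs"
    unfolding rows_less_def
  proof (intro allI impI)
    fix r assume r: "Some r \<in> set xs"
    then have "1 \<le> r"
      using lattice_word_dominant[OF assms(1)] shape_eq_0_iff[of xs r] by (cases r) (auto simp: dominant_def)
    then show "r < k"
      using lis_lattice_ge[OF assms(1) r, of 1 "[]"] * by auto
  qed
qed

lemma legal_drop: "legal n cs \<Longrightarrow> legal n (drop i cs)"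
  by (induction cs arbitrary: i) (auto simp: drop_Cons split: nat.split)

lemma arc_set_drop:
  assumes "length cs = n" "i \<le> n"
  shows "arc_set n (drop i cs) = {(a, b) \<in> arc_set n cs. i < b}"
proof -
  have "(\<exists>j<n - i. cs ! (i + j) = Some a \<and> b = Suc (i + j)) \<longleftrightarrow> (\<exists>j<n. cs ! j = Some a \<and> b = Suc j) \<and> i < b" for a b
  proof
    assume "(\<exists>j<n. cs ! j = Some a \<and> b = Suc j) \<and> i < b"
    then show "\<exists>j<n - i. cs ! (i + j) = Some a \<and> b = Suc (i + j)"
      by (intro exI[of _ "b - Suc i"]) auto
  qed auto
  then have "(a, b) \<in> arc_set n (drop i cs) \<longleftrightarrow> (a, b) \<in> arc_set n cs \<and> i < b" for a b
    using assms by (auto simp: arc_set_iff)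
  then show ?thesis
    by auto
qed

text \<open>The state reached after the elements above \<open>i\<close> has labels for
  \<open>1\<close> to \<open>i\<close>, so its rows bound the crossings among arcs that open at or
  before \<open>i\<close> and close after \<open>i\<close>.\<close>

lemma bounded_iff_crossing:
  assumes "legal n cs" "length cs = n" "k \<ge> 1"
  shows "bounded k n cs \<longleftrightarrow> (\<forall>i\<le>n. \<forall>m. crossing {(a, b) \<in> arc_set n cs. i < b} 1 (Suc i) m \<longrightarrow> m < k)"
proof -
  have "rows_less k (state n (drop i cs)) \<longleftrightarrow>
      (\<forall>m. crossing {(a, b) \<in> arc_set n cs. i < b} 1 (Suc i) m \<longrightarrow> m < k)" if i: "i \<le> n" for i
  proof -
    note props = state_props[OF legal_drop[OF assms(1), of i]]
    have "length (state n (drop i cs)) = i"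
      using props assms(2) i by simp
    then have "crossing {(a, b) \<in> arc_set n cs. i < b} 1 (Suc i) m \<longleftrightarrow> m \<le> lis 1 (state n (drop i cs))" for m
      using crossing_arc_set_iff[OF legal_drop[OF assms(1)], of i i 0 m] assms(2) i
      by (simp add: arc_set_drop)
    then show ?thesis
      using rows_less_iff_lis[of "state n (drop i cs)" k] props assms(3) le_less_trans by auto
  qed
  then show ?thesis
    using assms(2) by (simp add: bounded_def)
qed

section \<open>Choice lists described by their arcs\<close>

lemma state_nth_eq_None_iff:
  "legal n cs \<Longrightarrow> a < n - length cs \<Longrightarrow> state n cs ! a = None \<longleftrightarrow> (\<forall>b. (Suc a, b) \<notin> arc_set n cs)"
proof (induction cs)
  case (Cons c cs)
  then have "length (butlast (state n cs)) = n - Suc (length cs)"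
    using state_props[of n cs] by simp
  then show ?case
    using Cons by (cases c) (auto simp: arc_set_Cons nth_butlast place_nth_eq_None_iff)
qed simp

text \<open>The list form already gives each closer a single opener; legality adds that openers
  precede closers and that no label is opened twice.\<close>

lemma legal_iff:
  "legal n cs \<longleftrightarrow> length cs \<le> n \<and> (\<forall>(a, b)\<in>arc_set n cs. a < b) \<and> single_valued (arc_set n cs)"
proof (induction cs)
  case (Cons c cs)
  show ?case
  proof (cases "legal n cs \<and> length cs < n")
    case True
    then have "length (butlast (state n cs)) = n - Suc (length cs)"
      using state_props[of n cs] by simp
    then have "choice_ok c (butlast (state n cs)) \<longleftrightarrow>
        (\<forall>a. c = Some a \<longrightarrow> Suc a < n - length cs \<and> (\<forall>b. (Suc a, b) \<notin> arc_set n cs))"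
      using True state_nth_eq_None_iff[of n cs] by (cases c) (auto simp: nth_butlast)
    moreover have "(Suc a, n - length cs) \<notin> arc_set n cs" for a
      using arc_set_greater by blast
    moreover have "single_valued (insert (x, y) A) \<longleftrightarrow> single_valued A \<and> (\<forall>z. (x, z) \<notin> A)"
      if "(x, y) \<notin> A" for x y :: nat and A
      using that unfolding single_valued_def by blast
    ultimately show ?thesis
      using True Cons.IH by (cases c) (auto simp: arc_set_Cons)
  next
    case False
    show ?thesis
    proof (cases "length cs < n")
      case True
      \<comment> \<open>A violation in the tail persists, since its arcs remain arcs of the longer
        list.\<close>
      then have "arc_set n cs \<subseteq> arc_set n (c # cs)"
        by (auto simp: arc_set_Cons split: option.split)
      then have "\<not> ((\<forall>(a, b)\<in>arc_set n (c # cs). a < b) \<and> single_valued (arc_set n (c # cs)))"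
        using True False Cons.IH single_valued_subset by fastforce
      then show ?thesis
        using False by auto
    qed simp
  qed
qed simp

lemma arc_set_inj:
  assumes "length cs = n" "length ds = n" "arc_set n cs = arc_set n ds"
  shows "cs = ds"
proof (rule nth_equalityI)
  fix j assume "j < length cs"
  then have "cs ! j = Some a \<longleftrightarrow> (Suc a, Suc j) \<in> arc_set n cs" "ds ! j = Some a \<longleftrightarrow> (Suc a, Suc j) \<in> arc_set n ds" for a
    using assms(1,2) by (auto simp: arc_set_iff)
  then have "cs ! j = Some a \<longleftrightarrow> ds ! j = Some a" for a
    using assms(3) by simp
  then show "cs ! j = ds ! j"
    by (metis not_Some_eq)
qed (use assms in simp)

section \<open>Partitions and their arcs\<close>

context
  fixes n :: nat and P :: "nat set set"
  assumes partition: "partition_on {1..n} P"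
begin

lemma arcs_bounds: "(a, b) \<in> arcs P \<Longrightarrow> 1 \<le> a \<and> a < b \<and> b \<le> n"
  using partition_onD1[OF partition] by (auto simp: arcs_def)

lemma same_block: "B \<in> P \<Longrightarrow> B' \<in> P \<Longrightarrow> a \<in> B \<Longrightarrow> a \<in> B' \<Longrightarrow> B = B'"
  using partition_onD2[OF partition] by (auto simp: disjoint_def)

lemma single_valued_arcs: "single_valued (arcs P)"
  unfolding single_valued_def arcs_def using same_block by (auto; metis nat_neq_iff)

lemma single_valued_arcs_converse: "single_valued ((arcs P)\<inverse>)"
  unfolding single_valued_def arcs_def using same_block by (auto; metis nat_neq_iff)

text \<open>Steps back from \<open>b\<close> to its predecessor in the block, which an arc joins to
  \<open>b\<close>.\<close>

lemma block_connected: "B \<in> P \<Longrightarrow> a \<in> B \<Longrightarrow> b \<in> B \<Longrightarrow> a \<le> b \<Longrightarrow> (a, b) \<in> (arcs P)\<^sup>*"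
proof (induction "b - a" arbitrary: b rule: less_induct)
  case less
  show ?case
  proof (cases "a = b")
    case False
    define c where "c = Max {c \<in> B. c < b}"
    have "finite {c \<in> B. c < b}"
      by (rule finite_subset[of _ "{..<b}"]) auto
    moreover have "a \<in> {c \<in> B. c < b}"
      using less.prems False by simp
    ultimately have "c \<in> {c \<in> B. c < b}" and max: "\<And>d. d \<in> {c \<in> B. c < b} \<Longrightarrow> d \<le> c"
      unfolding c_def by (metis Max_in empty_iff, simp)
    then have c: "c \<in> B" "c < b" "a \<le> c"
      using \<open>a \<in> {c \<in> B. c < b}\<close> by simp_all
    have "\<not> (c < d \<and> d < b)" if "d \<in> B" for d
      using max[of d] that by auto
    then have "(c, b) \<in> arcs P"
      using less.prems(1,3) c(1,2) unfolding arcs_def by blast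
    moreover have "(a, c) \<in> (arcs P)\<^sup>*"
      using less.hyps[of c] c less.prems by auto
    ultimately show ?thesis
      by simp
  qed simp
qed

lemma connected_block: "(a, b) \<in> (arcs P)\<^sup>* \<Longrightarrow> B \<in> P \<Longrightarrow> a \<in> B \<longleftrightarrow> b \<in> B"
proof (induction rule: rtrancl_induct)
  case (step b c)
  then show ?case
    unfolding arcs_def using same_block by blast
qed simp

text \<open>The arcs alone recover the blocks, which makes \<open>arcs\<close> injective on
  partitions.\<close>

lemma block_eq: "B \<in> P \<Longrightarrow> a \<in> B \<Longrightarrow> B = {b. (a, b) \<in> (arcs P)\<^sup>* \<or> (b, a) \<in> (arcs P)\<^sup>*}"
  using block_connected connected_block nat_le_linear by blast

text \<open>A nonempty crossing is cut at its last opener \<open>i\<close>: all openers are at most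
  \<open>i\<close> and all closers exceed it.\<close>

lemma crossing_iff_is_crossing:
  "(\<exists>C. is_crossing m P C) \<longleftrightarrow> (\<exists>i\<le>n. crossing {(a, b) \<in> arcs P. i < b} 1 (Suc i) m)"
proof
  assume "\<exists>C. is_crossing m P C"
  then obtain "is" js where *: "length is = m" "length js = m" "sorted_wrt (<) (is @ js)" "set (zip is js) \<subseteq> arcs P"
    unfolding is_crossing_def by blast
  show "\<exists>i\<le>n. crossing {(a, b) \<in> arcs P. i < b} 1 (Suc i) m"
  proof (cases "m = 0")
    case False
    then have ne: "is \<noteq> []"
      using * by auto
    define i where "i = last is"
    have mem: "1 \<le> a \<and> a \<le> n" if "a \<in> set is" for a
      using in_set_zipD(1)[of "is" js a] that *(1,2,4) arcs_bounds[of a] by fastforce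
    have "sorted_wrt (<) (butlast is @ [i])"
      using *(3) ne by (simp add: i_def sorted_wrt_append)
    moreover have "set is = set (butlast is @ [i])"
      using ne by (simp add: i_def)
    ultimately have "a \<le> i" if "a \<in> set is" for a
      using that unfolding sorted_wrt_append by force
    then have "set is \<subseteq> {1..<Suc i}"
      using mem by (auto simp: less_Suc_eq_le)
    moreover have "i < b" if "b \<in> set js" for b
      using *(3) ne that by (simp add: sorted_wrt_append i_def)
    then have "set (zip is js) \<subseteq> {(a, b) \<in> arcs P. i < b}"
      using *(4) by (auto dest: set_zip_rightD)
    ultimately have "crossing {(a, b) \<in> arcs P. i < b} 1 (Suc i) m"
      using * unfolding crossing_def sorted_wrt_append by blast
    moreover have "i \<le> n"
      using mem ne by (simp add: i_def)
    ultimately show ?thesis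
      by blast
  qed auto
next
  assume "\<exists>i\<le>n. crossing {(a, b) \<in> arcs P. i < b} 1 (Suc i) m"
  then obtain i as bs where *: "length as = m" "length bs = m" "sorted_wrt (<) as" "sorted_wrt (<) bs"
      "set as \<subseteq> {1..<Suc i}" "set (zip as bs) \<subseteq> {(a, b) \<in> arcs P. i < b}"
    unfolding crossing_def by blast
  have "i < b" if "b \<in> set bs" for b
    using in_set_zipD(2)[of as bs b] that *(1,2,6) by fastforce
  then have "sorted_wrt (<) (as @ bs)"
    using *(3,4,5) by (fastforce simp: sorted_wrt_append)
  then have "is_crossing m P (set (zip as bs))"
    unfolding is_crossing_def using * by blast
  then show "\<exists>C. is_crossing m P C" ..
qed

lemma cr_less_iff:
  assumes "legal n cs" "length cs = n" "arc_set n cs = arcs P" "k \<ge> 1"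
  shows "cr P < k \<longleftrightarrow> bounded k n cs"
proof -
  have "cr P < k \<longleftrightarrow> (\<forall>m. (\<exists>C. is_crossing m P C) \<longrightarrow> m < k)"
    unfolding cr_def using finite_crossing_sizes[OF partition] by (subst Max_less_iff) auto
  then show ?thesis
    unfolding crossing_iff_is_crossing bounded_iff_crossing[OF assms(1,2,4)] assms(3) by blast
qed

lemma arcs_eq_arc_set:
  obtains cs where "length cs = n" "legal n cs" "arc_set n cs = arcs P"
proof -
  \<comment> \<open>The opener of the arc closing at \<open>j + 1\<close>, unambiguous because an
    element closes at most one arc.\<close>
  define c where "c j = (if \<exists>a. (Suc a, Suc j) \<in> arcs P then Some (SOME a. (Suc a, Suc j) \<in> arcs P) else None)" for j
  have c: "c j = Some a \<longleftrightarrow> (Suc a, Suc j) \<in> arcs P" for a j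
  proof
    assume "c j = Some a"
    then show "(Suc a, Suc j) \<in> arcs P"
      using someI_ex[of "\<lambda>a. (Suc a, Suc j) \<in> arcs P"] by (auto simp: c_def split: if_splits)
  next
    assume *: "(Suc a, Suc j) \<in> arcs P"
    then have "(SOME a. (Suc a, Suc j) \<in> arcs P) = a"
      using single_valued_arcs_converse by (intro some_equality) (auto simp: single_valued_def)
    then show "c j = Some a"
      using * by (auto simp: c_def)
  qed
  define cs where "cs = map c [0..<n]"
  have len: "length cs = n"
    by (simp add: cs_def)
  have "(x, y) \<in> arc_set n cs \<longleftrightarrow> (x, y) \<in> arcs P" for x y
    using arcs_bounds[of x y] by (cases x; cases y) (auto simp: arc_set_def cs_def c)
  then have arcs: "arc_set n cs = arcs P"
    by auto
  then have "legal n cs"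
    using len arcs_bounds single_valued_arcs by (auto simp: legal_iff)
  then show ?thesis
    using that len arcs by blast
qed

end

lemma arcs_inj:
  assumes "partition_on {1..n} P" "partition_on {1..n} Q" "arcs P = arcs Q"
  shows "P = Q"
proof -
  have "P \<subseteq> Q" if asm: "partition_on {1..n} P" "partition_on {1..n} Q" "arcs P = arcs Q" for P Q
  proof
    fix B assume B: "B \<in> P"
    then obtain a where a: "a \<in> B"
      using partition_onD3[OF asm(1)] by fastforce
    then obtain B' where B': "B' \<in> Q" "a \<in> B'"
      using B partition_onD1[OF asm(1)] partition_onD1[OF asm(2)] by blast
    have "B = B'"
      using block_eq[OF asm(1) B a] block_eq[OF asm(2) B'] asm(3) by simp
    then show "B \<in> Q"
      using B' by simp
  qed
  then show ?thesis
    using assms by (metis subset_antisym)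
qed

text \<open>Blocks are the classes of comparability under \<open>A\<^sup>*\<close>. Comparability is
  transitive because paths with a common start or a common end are comparable when \<open>A\<close>
  and its converse are single-valued.\<close>

lemma partition_of_arcs:
  assumes "A \<subseteq> {1..n} \<times> {1..n}" "\<And>a b. (a, b) \<in> A \<Longrightarrow> a < b" "single_valued A" "single_valued (A\<inverse>)"
  obtains P where "partition_on {1..n} P" "arcs P = A"
proof -
  define E where "E = {(a, b) \<in> {1..n} \<times> {1..n}. (a, b) \<in> A\<^sup>* \<or> (b, a) \<in> A\<^sup>*}"
  have confl: "(b, c) \<in> A\<^sup>* \<or> (c, b) \<in> A\<^sup>*" if "(a, b) \<in> A\<^sup>*" "(a, c) \<in> A\<^sup>*" for a b c
    using single_valued_confluent[OF assms(3)] that by blast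
  have confl': "(b, c) \<in> A\<^sup>* \<or> (c, b) \<in> A\<^sup>*" if "(b, a) \<in> A\<^sup>*" "(c, a) \<in> A\<^sup>*" for a b c
    using single_valued_confluent[OF assms(4), of a b c] that by (auto simp: rtrancl_converse)
  have "trans E"
  proof (rule transI)
    fix a b c
    assume "(a, b) \<in> E" "(b, c) \<in> E"
    then show "(a, c) \<in> E"
      using confl[of b a c] confl'[of a b c] by (auto simp: E_def intro: rtrancl_trans)
  qed
  then have equiv: "equiv {1..n} E"
    by (intro equivI refl_onI symI) (auto simp: E_def)
  define P where "P = {1..n} // E"
  have le: "a \<le> b" if "(a, b) \<in> A\<^sup>*" for a b
    using that by induction (auto dest: assms(2))
  have block: "(\<exists>B\<in>P. a \<in> B \<and> b \<in> B \<and> Q B) \<longleftrightarrow> (a, b) \<in> E \<and> Q (E `` {a})" for a b Q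
  proof
    assume "\<exists>B\<in>P. a \<in> B \<and> b \<in> B \<and> Q B"
    then show "(a, b) \<in> E \<and> Q (E `` {a})"
      unfolding P_def using equiv
      by (metis Image_singleton_iff quotientE equiv_class_eq)
  next
    assume "(a, b) \<in> E \<and> Q (E `` {a})"
    then show "\<exists>B\<in>P. a \<in> B \<and> b \<in> B \<and> Q B"
      unfolding P_def using equiv by (intro bexI[of _ "E `` {a}"]) (auto simp: E_def quotient_def)
  qed
  have "(a, b) \<in> arcs P \<longleftrightarrow> (a, b) \<in> A" for a b
  proof
    assume "(a, b) \<in> arcs P"
    then have *: "a < b" "(a, b) \<in> E" "\<And>c. (a, c) \<in> E \<Longrightarrow> \<not> (a < c \<and> c < b)"
      unfolding arcs_def mem_Collect_eq prod.case block by auto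
    then have "(a, b) \<in> A\<^sup>*"
      using le[of b a] by (auto simp: E_def)
    \<comment> \<open>The first arc of a path from \<open>a\<close> to \<open>b\<close> ends in the
      same class at some \<open>c\<close> with \<open>a < c\<close>; as no element of the class lies
      strictly between \<open>a\<close> and \<open>b\<close>, this is \<open>b\<close>.\<close>
    then obtain c where c: "(a, c) \<in> A" "(c, b) \<in> A\<^sup>*"
      using * by (metis converse_rtranclE less_irrefl)
    then have "(a, c) \<in> E" "a < c" "c \<le> b"
      using assms(1,2) le by (auto simp: E_def)
    then show "(a, b) \<in> A"
      using c * le_neq_implies_less by blast
  next
    assume ab: "(a, b) \<in> A"
    have "\<not> (a < c \<and> c < b)" if "(a, c) \<in> E" for c
    proof
      assume *: "a < c \<and> c < b"
      then have "(a, c) \<in> A\<^sup>*"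
        using that le[of c a] by (auto simp: E_def)
      \<comment> \<open>The path from \<open>a\<close> has to begin with the arc to
        \<open>b\<close>, so \<open>c\<close> cannot lie below \<open>b\<close>.\<close>
      then obtain d where "(a, d) \<in> A" "(d, c) \<in> A\<^sup>*"
        using * by (metis converse_rtranclE less_irrefl)
      then have "(b, c) \<in> A\<^sup>*"
        using ab assms(3) by (metis single_valuedD)
      then show False
        using le * by fastforce
    qed
    then show "(a, b) \<in> arcs P"
      using ab assms(1,2) unfolding arcs_def mem_Collect_eq prod.case block by (auto simp: E_def)
  qed
  then have "arcs P = A"
    by auto
  moreover have "partition_on {1..n} P"
    unfolding P_def using equiv by (rule partition_on_quotient)
  ultimately show ?thesis
    using that by blast
qed

theorem theorem10:
  fixes k n :: nat
  assumes "k \<ge> 2"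
  shows "card {P. partition_on {1..n} P \<and> cr P < k} = card (walks k n)"
proof -
  let ?P = "{P. partition_on {1..n} P \<and> cr P < k}"
  let ?C = "{cs. length cs = n \<and> legal n cs \<and> bounded k n cs}"
  \<comment> \<open>Partitions and choice lists are compared through their sets of arcs: both maps
    are injective and, under the two bounds, have the same image.\<close>
  have images: "arcs ` ?P = arc_set n ` ?C"
  proof (intro equalityI subsetI)
    fix A assume "A \<in> arcs ` ?P"
    then obtain P where P: "partition_on {1..n} P" "cr P < k" "A = arcs P"
      by blast
    obtain cs where "length cs = n" "legal n cs" "arc_set n cs = arcs P"
      using arcs_eq_arc_set[OF P(1)] by blast
    then show "A \<in> arc_set n ` ?C"
      using cr_less_iff[OF P(1), of cs k] P assms by auto
  next
    fix A assume "A \<in> arc_set n ` ?C"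
    then obtain cs where cs: "length cs = n" "legal n cs" "bounded k n cs" "A = arc_set n cs"
      by blast
    have less: "a < b" if "(a, b) \<in> A" for a b
      using cs(2,4) that unfolding legal_iff by blast
    have "1 \<le> a \<and> b \<le> n" if "(a, b) \<in> A" for a b
      using that cs(1,4) by (auto simp: arc_set_def)
    then have sub: "A \<subseteq> {1..n} \<times> {1..n}"
      using less by fastforce
    have sv: "single_valued (A\<inverse>)"
      using cs(1,4) by (auto simp: arc_set_def single_valued_def)
    have "single_valued A"
      using cs(2,4) by (simp add: legal_iff)
    then obtain P where P: "partition_on {1..n} P" "arcs P = A"
      using partition_of_arcs[OF sub less _ sv] by blast
    moreover have "cr P < k"
      using cr_less_iff[OF P(1) cs(2,1)] cs(3,4) P(2) assms by simp
    ultimately show "A \<in> arcs ` ?P"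
      by blast
  qed
  have "card ?P = card (arcs ` ?P)"
    using arcs_inj by (intro card_image[symmetric] inj_onI) blast
  also have "\<dots> = card (arc_set n ` ?C)"
    by (simp only: images)
  also have "\<dots> = card ?C"
    using arc_set_inj by (intro card_image inj_onI) blast
  also have "\<dots> = card (walks k n)"
    using bij_betw_shapes[of k n] assms by (intro bij_betw_same_card[of "shapes n"]) simp
  finally show ?thesis .
qed

end
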